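(* The infinite Turán number of $K_{2,2}$ satisfies \[ \mathrm{ex}( \infty , K_{2,2} ) \leq 0.41, \] where \[ \mathrm{ex}(\infty, K_{2,2}) = \sup_{G} \ \liminf_{n \rightarrow \infty} \frac{ e(G_n) }{n^{3/2} }, \] the supremum being over all infinite $K_{2,2}$-free graphs $G$ with $V(G) = \mathbb{N}$.
   Context: Graphs are simple. $\mathbb{N} = \{1,2,3,\dots\}$. A graph $G$ is $F$-free if it does not contain $F$ as a (not necessarily induced) subgraph. For an infinite graph $G$ with $V(G) = \mathbb{N}$, $G_n$ denotes the subgraph of $G$ induced by the vertices $\{1,2,\dots,n\}$, and $e(G_n)$ is its number of edges. For a bipartite graph $F$, $\alpha$ is the exponent of $F$ if there are positive constants $c_1, c_2$ with $c_1 n^{\alpha} \le \mathrm{ex}(n,F) \le c_2 n^{\alpha}$ for all sufficiently large $n$, where $\mathrm{ex}(n,F)$ is the maximum number of edges of an $n$-vertex $F$-free graph. The infinite Turán number of $F$ is $\mathrm{ex}(\infty,F) = \sup_G \liminf_{n\to\infty} e(G_n)/n^{\alpha}$, the supremum over all infinite $F$-free graphs $G$ with $V(G)=\mathbb{N}$. The exponent of $K_{2,2}$ is $3/2$. *)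

theory Defs
  imports "HOL-Library.Extended_Real"
begin

text \<open>Possibly infinite simple graphs: an edge is a two-element set of vertices.\<close>

record 'a graph =
  verts :: "'a set"
  edges :: "'a set set"

definition simple_graph :: "'a graph \<Rightarrow> bool" where
  "simple_graph G \<longleftrightarrow> (\<forall>e \<in> edges G. e \<subseteq> verts G \<and> card e = 2)"

definition induced_subgraph :: "'a graph \<Rightarrow> 'a set \<Rightarrow> 'a graph" where
  "induced_subgraph G S =
     \<lparr> verts = verts G \<inter> S, edges = {e \<in> edges G. e \<subseteq> S} \<rparr>"

definition contains_subgraph :: "'a graph \<Rightarrow> 'b graph \<Rightarrow> bool" where
  "contains_subgraph G F \<longleftrightarrow>
     (\<exists>f. inj_on f (verts F) \<and> f ` verts F \<subseteq> verts G \<and> (\<forall>e \<in> edges F. f ` e \<in> edges G))"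

definition graph_free :: "'b graph \<Rightarrow> 'a graph \<Rightarrow> bool" where
  "graph_free F G \<longleftrightarrow> \<not> contains_subgraph G F"

definition complete_bipartite :: "nat \<Rightarrow> nat \<Rightarrow> (nat + nat) graph" where
  "complete_bipartite s t =
     \<lparr> verts = {..<s} <+> {..<t},
       edges = {{Inl i, Inr j} | i j. i < s \<and> j < t} \<rparr>"

definition num_edges :: "'a graph \<Rightarrow> nat" where
  "num_edges G = card (edges G)"

definition initial_subgraph :: "nat graph \<Rightarrow> nat \<Rightarrow> nat graph" where
  "initial_subgraph G n = induced_subgraph G {1..n}"

text \<open>The vertex set is \<open>{1, 2, 3, \<dots>}\<close>. The parameter \<open>\<alpha>\<close> is meant to be the exponent of
  \<open>F\<close>, i.e. \<open>ex(n, F)\<close> has order of magnitude \<open>n powr \<alpha>\<close>; it is \<open>3/2\<close> for \<open>K\<^bsub>2,2\<^esub>\<close>. The lower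
  limit and the supremum are taken in the extended reals, so that both always exist and an
  upper bound on the supremum has content; a supremum in the reals would have an unspecified
  value if the set were unbounded.\<close>

definition infinite_turan_number :: "'b graph \<Rightarrow> real \<Rightarrow> ereal" where
  "infinite_turan_number F \<alpha> =
     (SUP G \<in> {G :: nat graph. simple_graph G \<and> verts G = {1..} \<and> graph_free F G}.
        liminf (\<lambda>n. ereal (real (num_edges (initial_subgraph G n)) / real n powr \<alpha>)))"

end

theory Submission
  imports Defs "HOL-Analysis.Convex"
begin

text \<open>
  If \<open>G\<close> is \<open>K\<^bsub>2,2\<^esub>\<close>-free, then two vertices of a set \<open>X\<close> have at most one common
  neighbour in the whole of \<open>G\<close>, not only in \<open>X\<close>. Cut an initial segment into blocks
  \<open>B\<^sub>i\<close> and let \<open>w\<^sub>i\<^sub>j\<close> be the number of adjacent pairs in \<open>B\<^sub>i \<times> B\<^sub>j\<close>. Counting the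
  common neighbours of pairs in \<open>B\<^sub>i\<close> and using Cauchy--Schwarz gives
  \<open>(\<Sum>j. w\<^sub>i\<^sub>j\<^sup>2 / |B\<^sub>j|) \<le> |B\<^sub>i|\<^sup>2 (1 + o(1))\<close>. For a suitable weighting of these
  inequalities, a second application of Cauchy--Schwarz bounds a positive combination of the
  numbers of edges of several initial segments. For the seven segments of lengths
  \<open>s\<^sup>2 P\<^sup>2\<close> with \<open>s = 1, 2, 3, 4, 6, 8, 11\<close> and \<open>P\<close> large, the weights below show that
  these numbers cannot all exceed \<open>0.41 n\<^bsup>3/2\<^esup>\<close>.
\<close>

section \<open>Adjacent pairs and edge counts\<close>

text \<open>Ordered pairs are counted, so an edge inside both sets counts twice. This makes the
  matrix over a block partition symmetric, with no special case on the diagonal.\<close>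

definition arcs :: "'a graph \<Rightarrow> 'a set \<Rightarrow> 'a set \<Rightarrow> real" where
  "arcs G X Y = (\<Sum>y\<in>Y. \<Sum>x\<in>X. of_bool ({x, y} \<in> edges G))"

lemma arcs_commute: "arcs G X Y = arcs G Y X"
  unfolding arcs_def by (subst sum.swap) (simp add: insert_commute)

lemma arcs_mono_left:
  assumes "finite X'" "X \<subseteq> X'"
  shows "arcs G X Y \<le> arcs G X' Y"
  unfolding arcs_def by (intro sum_mono sum_mono2) (use assms in auto)

text \<open>The map \<open>(y, x)\<close> to \<open>{x, y}\<close> sends adjacent ordered pairs onto
  edges, and its fibre over each edge has exactly two elements.\<close>

lemma arcs_self_eq_num_edges:
  assumes "simple_graph G" and "finite S" and "S \<subseteq> verts G"
  shows "arcs G S S = 2 * real (num_edges (induced_subgraph G S))"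
proof -
  let ?E = "{e \<in> edges G. e \<subseteq> S}"
  let ?A = "{(y, x) \<in> S \<times> S. {x, y} \<in> edges G}"
  have finE: "finite ?E"
    by (rule finite_subset[of _ "Pow S"]) (use assms in auto)
  have finA: "finite ?A"
    by (rule finite_subset[of _ "S \<times> S"]) (use assms in auto)
  have "arcs G S S = (\<Sum>p\<in>S \<times> S. of_bool (p \<in> ?A))"
    unfolding arcs_def sum.cartesian_product by (rule sum.cong) auto
  also have "\<dots> = real (card ?A)"
  proof -
    have "S \<times> S \<inter> {p. p \<in> ?A} = ?A" by auto
    then show ?thesis using assms(2) by (simp add: sum_of_bool_eq)
  qed
  also have "card ?A = (\<Sum>e\<in>?E. card {p \<in> ?A. {snd p, fst p} = e})"
  proof -
    have "(\<lambda>p. {snd p, fst p}) ` ?A \<subseteq> ?E" by auto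
    from sum.group[OF finA finE this, of "\<lambda>_. 1::nat"] show ?thesis
      unfolding card_eq_sum by simp
  qed
  also have "\<dots> = (\<Sum>e\<in>?E. 2)"
  proof (rule sum.cong[OF refl])
    fix e assume e: "e \<in> ?E"
    then have "card e = 2" using assms(1) by (auto simp: simple_graph_def)
    then obtain u v where uv: "e = {u, v}" "u \<noteq> v" by (auto simp: card_2_iff)
    have "{p \<in> ?A. {snd p, fst p} = e} = {(u, v), (v, u)}"
      using e uv by (auto simp: doubleton_eq_iff insert_commute)
    then show "card {p \<in> ?A. {snd p, fst p} = e} = 2" using uv by simp
  qed
  finally show ?thesis
    by (simp add: num_edges_def induced_subgraph_def)
qed

section \<open>Common neighbours in K22-free graphs\<close>

lemma K22_free_common_neighbour_unique:
  assumes "simple_graph G" and "graph_free (complete_bipartite 2 2) G" and "x \<noteq> x'"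
    and "{x, z} \<in> edges G" "{x', z} \<in> edges G" "{x, z'} \<in> edges G" "{x', z'} \<in> edges G"
  shows "z = z'"
proof (rule ccontr)
  assume "z \<noteq> z'"
  have edge: "u \<in> verts G \<and> v \<in> verts G \<and> u \<noteq> v" if "{u, v} \<in> edges G" for u v
    using assms(1) that by (force simp: simple_graph_def)
  \<comment> \<open>A second common neighbour completes a K22 with parts \<open>{x, x'}\<close> and
    \<open>{z, z'}\<close>. Injectivity across the parts holds because adjacent vertices are
    distinct.\<close>
  define f where "f = case_sum (\<lambda>i::nat. if i = 0 then x else x') (\<lambda>j::nat. if j = 0 then z else z')"
  have "inj_on f (verts (complete_bipartite 2 2))"
    using edge[OF assms(4)] edge[OF assms(5)] edge[OF assms(6)] edge[OF assms(7)]
      \<open>z \<noteq> z'\<close> assms(3)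
    by (auto simp: inj_on_def f_def complete_bipartite_def less_2_cases_iff split: if_splits)
  moreover have "f ` verts (complete_bipartite 2 2) \<subseteq> verts G"
    using edge[OF assms(4)] edge[OF assms(7)]
    by (auto simp: f_def complete_bipartite_def)
  moreover have "\<forall>e \<in> edges (complete_bipartite 2 2). f ` e \<in> edges G"
    using assms(4-7) by (auto simp: f_def complete_bipartite_def)
  ultimately show False
    using assms(2) unfolding graph_free_def contains_subgraph_def by blast
qed

lemma sum_of_bool_le_1:
  assumes "\<And>z z'. z \<in> Z \<Longrightarrow> z' \<in> Z \<Longrightarrow> P z \<Longrightarrow> P z' \<Longrightarrow> z = z'"
  shows "(\<Sum>z\<in>Z. of_bool (P z)) \<le> (1::real)"
proof (cases "finite Z")
  case True
  have "card (Z \<inter> {z. P z}) \<le> 1"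
    using True assms by (auto simp: card_le_Suc0_iff_eq)
  then show ?thesis using True by (simp add: sum_of_bool_eq)
qed simp

text \<open>The sum of squares counts triples \<open>(x, x', z)\<close> with \<open>z\<close>
  adjacent to both others: at most one \<open>z\<close> when \<open>x\<close> and \<open>x'\<close>
  differ, and the degree of \<open>x\<close> into \<open>Z\<close> when they agree.\<close>

lemma K22_free_sum_degree_squares:
  assumes "simple_graph G" and "graph_free (complete_bipartite 2 2) G" and "finite X"
  shows "(\<Sum>z\<in>Z. (\<Sum>x\<in>X. of_bool ({x, z} \<in> edges G))\<^sup>2) \<le> (real (card X))\<^sup>2 + arcs G X Z"
proof -
  let ?a = "\<lambda>x z. of_bool ({x, z} \<in> edges G) :: real"
  have "(\<Sum>z\<in>Z. (\<Sum>x\<in>X. ?a x z)\<^sup>2) = (\<Sum>z\<in>Z. \<Sum>x\<in>X. \<Sum>x'\<in>X. ?a x z * ?a x' z)"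
    by (simp add: power2_eq_square sum_product)
  also have "\<dots> = (\<Sum>x\<in>X. \<Sum>x'\<in>X. \<Sum>z\<in>Z. ?a x z * ?a x' z)"
    by (subst sum.swap, rule sum.cong[OF refl], subst sum.swap, rule refl)
  \<comment> \<open>The 1 is allowed on the diagonal too, which rounds the count of off-diagonal
    pairs up to the square of \<open>card X\<close>.\<close>
  also have "\<dots> \<le> (\<Sum>x\<in>X. \<Sum>x'\<in>X. 1 + (if x = x' then \<Sum>z\<in>Z. ?a x z else 0))"
  proof (intro sum_mono)
    fix x x'
    show "(\<Sum>z\<in>Z. ?a x z * ?a x' z) \<le> 1 + (if x = x' then \<Sum>z\<in>Z. ?a x z else 0)"
    proof (cases "x = x'")
      case True
      then show ?thesis by (simp flip: of_bool_conj)
    next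
      case False
      have "(\<Sum>z\<in>Z. ?a x z * ?a x' z) \<le> 1"
        unfolding of_bool_conj[symmetric]
        by (rule sum_of_bool_le_1)
          (use K22_free_common_neighbour_unique[OF assms(1,2) False] in blast)
      then show ?thesis using False by simp
    qed
  qed
  also have "\<dots> = (real (card X))\<^sup>2 + (\<Sum>x\<in>X. \<Sum>z\<in>Z. ?a x z)"
    using assms(3) by (simp add: sum.distrib power2_eq_square)
  also have "(\<Sum>x\<in>X. \<Sum>z\<in>Z. ?a x z) = arcs G X Z"
    unfolding arcs_def by (rule sum.swap)
  finally show ?thesis .
qed

lemma arcs_square_le:
  "(arcs G X Y)\<^sup>2 / card Y \<le> (\<Sum>y\<in>Y. (\<Sum>x\<in>X. of_bool ({x, y} \<in> edges G))\<^sup>2)"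
\<comment> \<open>This case covers empty and infinite \<open>Y\<close>; the quotient is then
  0.\<close>
proof (cases "card Y = 0")
  case False
  then show ?thesis
    using sum_squared_le_sum_of_squares[of "\<lambda>y. \<Sum>x\<in>X. of_bool ({x, y} \<in> edges G)" Y]
    by (simp add: arcs_def divide_le_eq)
qed (simp add: sum_nonneg)

text \<open>A crude bound of the right order, needed only to make the linear error term negligible.
  The degree-square bound gives \<open>w * (w - q^2) \<le> q^6\<close> for the count
  \<open>w\<close>, but \<open>w > 2 * q^3\<close> would make both factors exceed
  \<open>q^3\<close>.\<close>

lemma K22_free_arcs_le:
  assumes "simple_graph G" and "graph_free (complete_bipartite 2 2) G"
    and "card S = q\<^sup>2" and "q > 0"
  shows "arcs G S S \<le> 2 * real q ^ 3"
proof -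
  have fin: "finite S" by (rule card_ge_0_finite) (use assms in simp)
  let ?w = "arcs G S S"
  have "?w\<^sup>2 / (real q)\<^sup>2 \<le> (real q ^ 2)\<^sup>2 + ?w"
    using order_trans[OF arcs_square_le K22_free_sum_degree_squares[OF assms(1,2) fin, of S]]
    by (simp add: assms(3))
  then have le: "?w\<^sup>2 \<le> real q ^ 6 + ?w * (real q)\<^sup>2"
    using \<open>q > 0\<close> by (simp add: divide_le_eq algebra_simps flip: power_add)
  show ?thesis
  proof (rule ccontr)
    assume "\<not> ?thesis"
    then have gt: "?w > 2 * real q ^ 3" by simp
    have "real q ^ 2 \<le> real q ^ 3"
      by (rule power_increasing) (use assms(4) in auto)
    moreover have "real q ^ 3 > 0" using assms(4) by simp
    ultimately have "real q ^ 3 < ?w" "real q ^ 3 < ?w - (real q)\<^sup>2"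
      using gt by linarith+
    then have "real q ^ 3 * real q ^ 3 < ?w * (?w - (real q)\<^sup>2)"
      using \<open>real q ^ 3 > 0\<close> by (intro mult_strict_mono) linarith+
    with le show False by (simp add: power2_eq_square algebra_simps flip: power_add)
  qed
qed

section \<open>Decomposition into consecutive blocks\<close>

lemma sum_consecutive_blocks:
  fixes m :: "nat \<Rightarrow> nat"
  assumes "\<And>i. i < k \<Longrightarrow> m i \<le> m (Suc i)"
  shows "(\<Sum>i<k. sum f {m i<..m (Suc i)}) = sum f {m 0<..m k}"
  using assms
proof (induction k)
  case (Suc k)
  note step = Suc.prems
  have "m 0 \<le> m j" if "j \<le> k" for j
    using that
  proof (induction j)
    case (Suc j)
    then show ?case using step[of j] by simp
  qed simp
  then have "{m 0<..m (Suc k)} = {m 0<..m k} \<union> {m k<..m (Suc k)}"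
    using step[of k] by fastforce
  moreover have "{m 0<..m k} \<inter> {m k<..m (Suc k)} = {}" by auto
  ultimately show ?case using Suc by (simp add: sum.union_disjoint)
qed simp

lemma arcs_consecutive_blocks:
  fixes m :: "nat \<Rightarrow> nat"
  assumes "\<And>i. i < k \<Longrightarrow> m i \<le> m (Suc i)"
  shows "(\<Sum>i<k. \<Sum>j<k. arcs G {m i<..m (Suc i)} {m j<..m (Suc j)})
    = arcs G {m 0<..m k} {m 0<..m k}"
proof -
  have "(\<Sum>j<k. arcs G X {m j<..m (Suc j)}) = arcs G X {m 0<..m k}" for X
    unfolding arcs_def by (rule sum_consecutive_blocks[of k m, OF assms])
  moreover from this have "(\<Sum>i<k. arcs G {m i<..m (Suc i)} X) = arcs G {m 0<..m k} X" for X
    by (simp add: arcs_commute[of G _ X])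
  ultimately show ?thesis by simp
qed

text \<open>Cauchy--Schwarz is applied in each block separately, but common neighbours are counted
  over all blocks at once, so the blocks share a single budget of \<open>(card X)^2\<close>. The
  linear term is enlarged to one that does not depend on \<open>X\<close>.\<close>

lemma K22_free_sum_arcs_squares:
  fixes m :: "nat \<Rightarrow> nat"
  assumes "simple_graph G" and "graph_free (complete_bipartite 2 2) G"
    and "\<And>i. i < k \<Longrightarrow> m i \<le> m (Suc i)" and "finite X" and "X \<subseteq> {m 0<..m k}"
  shows "(\<Sum>j<k. (arcs G X {m j<..m (Suc j)})\<^sup>2 / real (m (Suc j) - m j))
    \<le> (real (card X))\<^sup>2 + arcs G {m 0<..m k} {m 0<..m k}"
proof -
  let ?d = "\<lambda>z. (\<Sum>x\<in>X. of_bool ({x, z} \<in> edges G))\<^sup>2 :: real"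
  have "(\<Sum>j<k. (arcs G X {m j<..m (Suc j)})\<^sup>2 / real (m (Suc j) - m j))
      \<le> (\<Sum>j<k. sum ?d {m j<..m (Suc j)})"
    using arcs_square_le[of G X "{m _<..m (Suc _)}"] by (intro sum_mono) simp
  also have "\<dots> = sum ?d {m 0<..m k}"
    by (rule sum_consecutive_blocks[of k m, OF assms(3)])
  also have "\<dots> \<le> (real (card X))\<^sup>2 + arcs G X {m 0<..m k}"
    by (rule K22_free_sum_degree_squares[OF assms(1,2,4)])
  also have "arcs G X {m 0<..m k} \<le> arcs G {m 0<..m k} {m 0<..m k}"
    using assms(5) by (intro arcs_mono_left) auto
  finally show ?thesis by simp
qed

section \<open>Weighted Cauchy--Schwarz bound\<close>

text \<open>Summation by parts in two indices: \<open>x i j\<close> occurs in the square of index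
  \<open>r\<close> exactly when \<open>max i j \<le> r\<close>, so its coefficient is a tail sum of
  the weights.\<close>

lemma weighted_partial_sums:
  fixes x :: "nat \<Rightarrow> nat \<Rightarrow> real"
  shows "(\<Sum>r<k. \<alpha> r * (\<Sum>i<Suc r. \<Sum>j<Suc r. x i j))
    = (\<Sum>i<k. \<Sum>j<k. (\<Sum>r\<in>{max i j..<k}. \<alpha> r) * x i j)"
proof -
  have "(\<Sum>r<k. \<alpha> r * (\<Sum>i<Suc r. \<Sum>j<Suc r. x i j))
      = (\<Sum>r<k. \<Sum>i<k. \<Sum>j<k. of_bool (max i j \<le> r) * \<alpha> r * x i j)"
  proof (rule sum.cong[OF refl])
    fix r assume r: "r \<in> {..<k}"
    have "(\<Sum>i<k. \<Sum>j<k. of_bool (max i j \<le> r) * \<alpha> r * x i j)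
        = (\<Sum>i<Suc r. \<Sum>j<k. of_bool (max i j \<le> r) * \<alpha> r * x i j)"
      using r by (intro sum.mono_neutral_right) auto
    also have "\<dots> = (\<Sum>i<Suc r. \<Sum>j<Suc r. of_bool (max i j \<le> r) * \<alpha> r * x i j)"
      using r by (intro sum.cong[OF refl] sum.mono_neutral_right) auto
    also have "\<dots> = (\<Sum>i<Suc r. \<Sum>j<Suc r. \<alpha> r * x i j)"
      by (intro sum.cong[OF refl]) auto
    finally show "\<alpha> r * (\<Sum>i<Suc r. \<Sum>j<Suc r. x i j)
        = (\<Sum>i<k. \<Sum>j<k. of_bool (max i j \<le> r) * \<alpha> r * x i j)"
      by (simp only: sum_distrib_left)
  qed
  also have "\<dots> = (\<Sum>i<k. \<Sum>j<k. \<Sum>r<k. of_bool (max i j \<le> r) * \<alpha> r * x i j)"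
    by (subst sum.swap, rule sum.cong[OF refl], subst sum.swap, rule refl)
  also have "\<dots> = (\<Sum>i<k. \<Sum>j<k. (\<Sum>r\<in>{max i j..<k}. \<alpha> r) * x i j)"
  proof (intro sum.cong[OF refl])
    fix i j
    have "(\<Sum>r<k. of_bool (max i j \<le> r) * \<alpha> r * x i j)
        = (\<Sum>r\<in>{max i j..<k}. of_bool (max i j \<le> r) * \<alpha> r * x i j)"
      by (rule sum.mono_neutral_right) auto
    then show "(\<Sum>r<k. of_bool (max i j \<le> r) * \<alpha> r * x i j)
        = (\<Sum>r\<in>{max i j..<k}. \<alpha> r) * x i j"
      by (simp add: sum_distrib_right)
  qed
  finally show ?thesis .
qed

text \<open>Since \<open>x\<close> is symmetric, averaging the weighted hypotheses over \<open>(i, j)\<close> and \<open>(j, i)\<close>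
  gives \<open>(x i j)\<^sup>2\<close> the coefficient \<open>(\<beta> i / D j + \<beta> j / D i) / 2\<close>.\<close>

lemma weighted_sum_square_le:
  fixes x :: "nat \<Rightarrow> nat \<Rightarrow> real"
  assumes sym: "\<And>i j. x i j = x j i"
    and pos: "\<And>i. i < k \<Longrightarrow> 0 < D i" "\<And>i. i < k \<Longrightarrow> 0 < \<beta> i"
    and le: "\<And>i. i < k \<Longrightarrow> (\<Sum>j<k. (x i j)\<^sup>2 / D j) \<le> c i"
  shows "(\<Sum>i<k. \<Sum>j<k. a i j * x i j)\<^sup>2
    \<le> (\<Sum>i<k. \<Sum>j<k. (a i j)\<^sup>2 / ((\<beta> i / D j + \<beta> j / D i) / 2)) * (\<Sum>i<k. \<beta> i * c i)"
proof -
  define \<kappa> where "\<kappa> i j = (\<beta> i / D j + \<beta> j / D i) / 2" for i j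
  have \<kappa>pos: "0 < \<kappa> i j" if "i < k" "j < k" for i j
    using that pos by (simp add: \<kappa>_def add_pos_pos)
  let ?I = "{..<k} \<times> {..<k}"
  \<comment> \<open>Dividing by the root of \<open>\<kappa> i j\<close> in one factor and
    multiplying in the other leaves the sum of \<open>\<kappa> i j * (x i j)^2\<close>, the quantity
    that the hypotheses control.\<close>
  have "(\<Sum>i<k. \<Sum>j<k. a i j * x i j)
      = (\<Sum>(i, j)\<in>?I. (a i j / sqrt (\<kappa> i j)) * (sqrt (\<kappa> i j) * x i j))"
    unfolding sum.cartesian_product
    by (rule sum.cong) (auto dest: \<kappa>pos)
  also have "\<dots>\<^sup>2 \<le> (\<Sum>(i, j)\<in>?I. (a i j / sqrt (\<kappa> i j))\<^sup>2) * (\<Sum>(i, j)\<in>?I. (sqrt (\<kappa> i j) * x i j)\<^sup>2)"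
    using Cauchy_Schwarz_ineq_sum[of "\<lambda>(i, j). a i j / sqrt (\<kappa> i j)" "\<lambda>(i, j). sqrt (\<kappa> i j) * x i j" ?I]
    by (simp add: case_prod_unfold)
  also have "(\<Sum>(i, j)\<in>?I. (a i j / sqrt (\<kappa> i j))\<^sup>2) = (\<Sum>i<k. \<Sum>j<k. (a i j)\<^sup>2 / \<kappa> i j)"
    unfolding sum.cartesian_product
    by (rule sum.cong) (auto simp: power_divide less_imp_le[OF \<kappa>pos])
  also have "(\<Sum>(i, j)\<in>?I. (sqrt (\<kappa> i j) * x i j)\<^sup>2) = (\<Sum>i<k. \<Sum>j<k. \<kappa> i j * (x i j)\<^sup>2)"
    unfolding sum.cartesian_product
    by (rule sum.cong) (auto simp: power_mult_distrib less_imp_le[OF \<kappa>pos])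
  also have "\<dots> = (\<Sum>i<k. \<beta> i * (\<Sum>j<k. (x i j)\<^sup>2 / D j))"
  proof -
    have "(\<Sum>i<k. \<Sum>j<k. \<beta> j / D i * (x i j)\<^sup>2) = (\<Sum>i<k. \<Sum>j<k. \<beta> i / D j * (x i j)\<^sup>2)"
      by (subst sum.swap) (simp add: sym)
    moreover have "(\<Sum>i<k. \<Sum>j<k. \<kappa> i j * (x i j)\<^sup>2)
        = (\<Sum>i<k. \<Sum>j<k. \<beta> i / D j * (x i j)\<^sup>2) / 2
          + (\<Sum>i<k. \<Sum>j<k. \<beta> j / D i * (x i j)\<^sup>2) / 2"
      unfolding \<kappa>_def sum_divide_distrib sum.distrib[symmetric]
      by (intro sum.cong refl) (simp add: add_divide_distrib distrib_right)
    ultimately show ?thesis by (simp add: sum_distrib_left)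
  qed
  also have "(\<Sum>i<k. \<Sum>j<k. (a i j)\<^sup>2 / \<kappa> i j) * (\<Sum>i<k. \<beta> i * (\<Sum>j<k. (x i j)\<^sup>2 / D j))
      \<le> (\<Sum>i<k. \<Sum>j<k. (a i j)\<^sup>2 / \<kappa> i j) * (\<Sum>i<k. \<beta> i * c i)"
    using le
    by (intro mult_left_mono sum_mono sum_nonneg)
      (auto simp: less_imp_le[OF pos(2)] less_imp_le[OF \<kappa>pos])
  finally show ?thesis by (simp add: \<kappa>_def)
qed

section \<open>Numerical data\<close>

text \<open>These are square roots of segment lengths up to scaling, so that powers with exponent
  3/2 become exact cubes and the certificate is rational. The leading 0 is the left end of the first
  block.\<close>

definition grid :: "nat \<Rightarrow> nat" where
  "grid = (!) [0, 1, 2, 3, 4, 6, 8, 11]"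

text \<open>The weights come from numerically minimising the bound that
  \<open>weighted_sum_square_le\<close> yields for this grid; the optimum, about \<open>0.407\<close>, leaves room
  for rounding.\<close>

definition segment_weight :: "nat \<Rightarrow> real" where
  "segment_weight = (!) [750, 160, 50, 28, 8, 3, 1]"

definition block_weight :: "nat \<Rightarrow> real" where
  "block_weight = (!) [9000, 1400, 400, 150, 25, 7, 1]"

lemma grid_simps: "grid 0 = 0" "grid 7 = 11"
  by (simp_all add: grid_def)

lemma grid_less: "i < 7 \<Longrightarrow> grid i < grid (Suc i)"
  and grid_le: "i < 7 \<Longrightarrow> grid (Suc i) \<le> 11"
  and segment_weight_pos: "i < 7 \<Longrightarrow> 0 < segment_weight i"
  and block_weight_pos: "i < 7 \<Longrightarrow> 0 < block_weight i"
proof -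
  have "\<forall>i<7. grid i < grid (Suc i) \<and> grid (Suc i) \<le> 11 \<and> 0 < segment_weight i \<and> 0 < block_weight i"
    by (simp add: grid_def segment_weight_def block_weight_def eval_nat_numeral All_less_Suc)
  then show "i < 7 \<Longrightarrow> grid i < grid (Suc i)" "i < 7 \<Longrightarrow> grid (Suc i) \<le> 11"
    "i < 7 \<Longrightarrow> 0 < segment_weight i" "i < 7 \<Longrightarrow> 0 < block_weight i"
    by auto
qed

text \<open>The final contradiction as one inequality between rationals: the Cauchy--Schwarz upper
  bound lies below the lower bound assumed for the same combination. The 1/100 is room for the
  linear error term.\<close>

lemma weights_certificate:
  fixes D :: "nat \<Rightarrow> real"
  assumes "D = (\<lambda>i. (real (grid (Suc i)))\<^sup>2 - (real (grid i))\<^sup>2)"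
  shows "(\<Sum>i<7. \<Sum>j<7. (\<Sum>r\<in>{max i j..<7}. segment_weight r)\<^sup>2 /
            ((block_weight i / D j + block_weight j / D i) / 2)) *
         (\<Sum>i<7. block_weight i * ((D i)\<^sup>2 + 1/100))
       < (\<Sum>r<7. segment_weight r * (41/50 * real (grid (Suc r)) ^ 3))\<^sup>2"
  unfolding assms grid_def segment_weight_def block_weight_def
  by (simp add: eval_nat_numeral)

section \<open>Contradiction from a large lower limit\<close>

theorem theorem1p3:
  shows "infinite_turan_number (complete_bipartite 2 2) (3/2) \<le> ereal (41/100)"
  unfolding infinite_turan_number_def
proof (rule SUP_least, rule ccontr)
  fix G :: "nat graph"
  let ?e = "\<lambda>n. real (num_edges (initial_subgraph G n))"
  assume "G \<in> {G. simple_graph G \<and> verts G = {1..} \<and> graph_free (complete_bipartite 2 2) G}"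
  then have G: "simple_graph G" "verts G = {1..}" "graph_free (complete_bipartite 2 2) G"
    by auto
  assume "\<not> liminf (\<lambda>n. ereal (?e n / real n powr (3/2))) \<le> ereal (41/100)"
  \<comment> \<open>A lower limit above 0.41 constrains all large \<open>n\<close>, hence all seven
    segments simultaneously.\<close>
  then have "\<forall>\<^sub>F n in sequentially. ereal (41/100) < ereal (?e n / real n powr (3/2))"
    by (intro less_LiminfD) simp
  then obtain n0 where n0: "\<And>n. n \<ge> n0 \<Longrightarrow> 41/100 < ?e n / real n powr (3/2)"
    by (auto simp: eventually_sequentially)
  \<comment> \<open>266200 is 100 times \<open>2 * 11 ^ 3\<close>: the crude bound on the longest
    segment, \<open>2 * (11 * P) ^ 3\<close>, is then at most \<open>P ^ 4 / 100\<close>.\<close>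
  define P where "P = max n0 266200"
  have P: "n0 \<le> P" "real P \<ge> 266200" "P > 0" by (auto simp: P_def)
  define m where "m i = (grid i * P)\<^sup>2" for i
  define D where "D = (\<lambda>i. (real (grid (Suc i)))\<^sup>2 - (real (grid i))\<^sup>2)"
  \<comment> \<open>Blocks have \<open>D i * P^2\<close> vertices, so dividing by
    \<open>P ^ 3\<close> removes \<open>P\<close> from the main terms on both sides.\<close>
  define x where "x i j = arcs G {m i<..m (Suc i)} {m j<..m (Suc j)} / real P ^ 3" for i j

  have m_mono: "m i \<le> m (Suc i)" if "i < 7" for i
    using grid_less[OF that] by (simp add: m_def power_mono)
  have D_pos: "0 < D i" if "i < 7" for i
    using grid_less[OF that] by (simp add: D_def power_strict_mono)
  have card_block: "real (m (Suc i) - m i) = D i * (real P)\<^sup>2" if "i < 7" for i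
    using m_mono[OF that] by (simp add: m_def D_def of_nat_diff power_mult_distrib algebra_simps)

  have upper: "(\<Sum>j<7. (x i j)\<^sup>2 / D j) \<le> (D i)\<^sup>2 + 1/100" if i: "i < 7" for i
  proof -
    let ?B = "{m i<..m (Suc i)}"
    have "arcs G {m 0<..m 7} {m 0<..m 7} \<le> 2 * real (11 * P) ^ 3"
      using P by (intro K22_free_arcs_le[OF G(1,3)]) (auto simp: m_def grid_simps)
    also have "\<dots> = 2662 * real P ^ 3" by (simp add: power_mult_distrib)
    also have "\<dots> \<le> (real P / 100) * real P ^ 3"
      using P by (intro mult_right_mono) auto
    finally have arcs_le: "arcs G {m 0<..m 7} {m 0<..m 7} \<le> real P ^ 4 / 100"
      by (simp add: eval_nat_numeral)
    have "m (Suc i) \<le> m 7"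
      unfolding m_def grid_simps by (intro power_mono mult_right_mono grid_le i) simp_all
    then have "?B \<subseteq> {m 0<..m 7}" by (auto simp: m_def grid_simps)
    then have "(\<Sum>j<7. (arcs G ?B {m j<..m (Suc j)})\<^sup>2 / real (m (Suc j) - m j))
        \<le> (D i * (real P)\<^sup>2)\<^sup>2 + real P ^ 4 / 100"
      using K22_free_sum_arcs_squares[of G 7 m ?B, OF G(1,3) m_mono] arcs_le card_block[OF i]
      by simp
    also have "\<dots> = real P ^ 4 * ((D i)\<^sup>2 + 1/100)"
      by (simp add: power_mult_distrib algebra_simps flip: power_mult)
    finally have "(\<Sum>j<7. (arcs G ?B {m j<..m (Suc j)})\<^sup>2 / real (m (Suc j) - m j)) / real P ^ 4
        \<le> (D i)\<^sup>2 + 1/100"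
      using P by (simp add: divide_le_eq mult.commute)
    also have "(\<Sum>j<7. (arcs G ?B {m j<..m (Suc j)})\<^sup>2 / real (m (Suc j) - m j)) / real P ^ 4
        = (\<Sum>j<7. (x i j)\<^sup>2 / D j)"
      unfolding sum_divide_distrib
    proof (rule sum.cong[OF refl])
      fix j :: nat assume "j \<in> {..<7}"
      then show "(arcs G ?B {m j<..m (Suc j)})\<^sup>2 / real (m (Suc j) - m j) / real P ^ 4
          = (x i j)\<^sup>2 / D j"
        using P by (simp add: card_block x_def power_divide mult_ac flip: power_add power_mult)
    qed
    finally show ?thesis .
  qed

  \<comment> \<open>The factor is 41/50, twice 41/100, because \<open>arcs\<close> counts every edge
    twice.\<close>
  have lower: "41/50 * real (grid (Suc r)) ^ 3 \<le> (\<Sum>i<Suc r. \<Sum>j<Suc r. x i j)" if r: "r < 7" for r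
  proof -
    let ?q = "grid (Suc r) * P"
    have q: "?q > 0" using grid_less[OF r] P by simp
    have "P \<le> ?q" using grid_less[OF r] by simp
    also have "?q \<le> m (Suc r)" unfolding m_def by (rule self_le_power) (use q in auto)
    finally have "41/100 < ?e (m (Suc r)) / real (m (Suc r)) powr (3/2)"
      using P by (intro n0) simp
    moreover have "real (m (Suc r)) powr (3/2) = real ?q ^ 3"
    proof -
      have "real (m (Suc r)) powr (3/2) = (real ?q powr 2) powr (3/2)"
        using q by (simp add: m_def)
      also have "\<dots> = real ?q powr 3" by (subst powr_powr) simp
      finally show ?thesis using q by simp
    qed
    ultimately have "41/100 * real ?q ^ 3 < ?e (m (Suc r))"
      using q by (simp add: less_divide_eq)
    moreover have "arcs G {0<..m (Suc r)} {0<..m (Suc r)} = 2 * ?e (m (Suc r))"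
    proof -
      have "{0<..m (Suc r)} = {1..m (Suc r)}" by auto
      moreover have "{1..m (Suc r)} \<subseteq> verts G" using G(2) by auto
      ultimately show ?thesis
        unfolding initial_subgraph_def by (simp only: arcs_self_eq_num_edges[OF G(1)] finite_atLeastAtMost)
    qed
    moreover have "(\<Sum>i<Suc r. \<Sum>j<Suc r. x i j)
        = arcs G {0<..m (Suc r)} {0<..m (Suc r)} / real P ^ 3"
      using arcs_consecutive_blocks[of "Suc r" m G] m_mono r
      by (simp only: x_def flip: sum_divide_distrib) (simp add: m_def grid_simps)
    ultimately show ?thesis
      using P by (simp add: le_divide_eq power_mult_distrib mult_ac)
  qed

  \<comment> \<open>\<open>?a i j\<close> is the total weight of the segments containing both block
    \<open>i\<close> and block \<open>j\<close>.\<close>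
  let ?a = "\<lambda>i j. \<Sum>r\<in>{max i j..<7}. segment_weight r"
  have "(\<Sum>r<7. segment_weight r * (41/50 * real (grid (Suc r)) ^ 3))
      \<le> (\<Sum>r<7. segment_weight r * (\<Sum>i<Suc r. \<Sum>j<Suc r. x i j))"
    using lower segment_weight_pos
    by (intro sum_mono mult_left_mono) (auto intro: less_imp_le)
  also have "\<dots> = (\<Sum>i<7. \<Sum>j<7. ?a i j * x i j)"
    by (rule weighted_partial_sums)
  finally have "(\<Sum>r<7. segment_weight r * (41/50 * real (grid (Suc r)) ^ 3))\<^sup>2
      \<le> (\<Sum>i<7. \<Sum>j<7. ?a i j * x i j)\<^sup>2"
    using segment_weight_pos
    by (intro power_mono sum_nonneg mult_nonneg_nonneg) (auto intro: less_imp_le)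
  also have "\<dots> \<le> (\<Sum>i<7. \<Sum>j<7. (?a i j)\<^sup>2 / ((block_weight i / D j + block_weight j / D i) / 2))
      * (\<Sum>i<7. block_weight i * ((D i)\<^sup>2 + 1/100))"
    using D_pos block_weight_pos upper
    by (intro weighted_sum_square_le) (auto simp: x_def arcs_commute)
  also have "\<dots> < (\<Sum>r<7. segment_weight r * (41/50 * real (grid (Suc r)) ^ 3))\<^sup>2"
    by (rule weights_certificate[OF D_def])
  finally show False by simp
qed

end
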